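(* Let $n\ge 5$ and let $G$ be an $n$-vertex $3$-graph containing no tight path $P_4^3$ with four edges. Then $e(G)\le|\partial(G)|$.
   Context: A $3$-graph is a (finite) $3$-uniform hypergraph; $e(G)$ is the number of edges of $G$. The shadow of a $3$-graph $G$ is $\partial(G)=\{S: |S|=2,\ S\subseteq e\text{ for some }e\in E(G)\}$. The $3$-uniform tight path $P_4^3$ with four edges is the $3$-graph on six distinct vertices $v_1,\dots,v_6$ with edges $\{v_1,v_2,v_3\},\{v_2,v_3,v_4\},\{v_3,v_4,v_5\},\{v_4,v_5,v_6\}$. $G$ contains $P_4^3$ if there is an injection $V(P_4^3)\to V(G)$ mapping every edge of $P_4^3$ to an edge of $G$. *)

theory Defs
  imports Main
begin

definition three_graph :: "'a set \<Rightarrow> 'a set set \<Rightarrow> bool" where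
  "three_graph V E \<longleftrightarrow> finite V \<and> (\<forall>e\<in>E. e \<subseteq> V \<and> card e = 3)"

definition shadow :: "'a set set \<Rightarrow> 'a set set" where
  "shadow E = {S. card S = 2 \<and> (\<exists>e\<in>E. S \<subseteq> e)}"

(* Containment as a not necessarily induced subhypergraph: (VH, EH) embeds into (V, E). *)
definition contains_copy :: "'a set \<Rightarrow> 'a set set \<Rightarrow> 'b set \<Rightarrow> 'b set set \<Rightarrow> bool" where
  "contains_copy V E VH EH \<longleftrightarrow>
     (\<exists>f. inj_on f VH \<and> f ` VH \<subseteq> V \<and> (\<forall>e\<in>EH. f ` e \<in> E))"

definition tight_path4_verts :: "nat set" where
  "tight_path4_verts = {1..6}"

definition tight_path4_edges :: "nat set set" where
  "tight_path4_edges = {{1, 2, 3}, {2, 3, 4}, {3, 4, 5}, {4, 5, 6}}"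

end

theory Submission
  imports Defs Complex_Main
begin

text \<open>
  In a counterexample with fewest edges, deleting any nonempty edge set \<open>F\<close> destroys fewer than
  \<open>|F|\<close> shadow pairs; hence every shadow pair has codegree at least 2.  If \<open>xyu\<close> and \<open>xyv\<close> are
  edges, the absence of a tight path forces any \<open>a \<in> N(xu) - {y, v}\<close> and
  \<open>f \<in> N(yv) - {x, u}\<close> to coincide.  From this, an edge with two pairs of codegree at least 4
  would produce three edges \<open>xyv\<close>, \<open>xzv\<close>, \<open>yzv\<close> that alone cover the pairs \<open>xv\<close>, \<open>yv\<close>, \<open>zv\<close>, so
  their deletion would destroy three pairs.
  Now give each edge the weight \<open>\<Sum> 1 / d(p)\<close> over its three pairs \<open>p\<close>; the total weight is
  the size of the shadow.  An edge whose codegrees are all at most 3 has weight at least 1.  For a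
  pair \<open>xy\<close> of codegree \<open>d \<ge> 4\<close>, all pairs \<open>xz\<close>, \<open>yz\<close> with \<open>z \<in> N(xy)\<close> have codegree 2 or 3,
  at most six of them have codegree 3, so the \<open>d\<close> edges at \<open>xy\<close> weigh at least
  \<open>1 + d - 6/6 = d\<close> altogether.
\<close>

section \<open>Links, tight paths and shadows\<close>

definition link_set :: "'a set set \<Rightarrow> 'a \<Rightarrow> 'a \<Rightarrow> 'a set" where
  "link_set E x y = {z. {x, y, z} \<in> E}"

text \<open>Six named vertices replace the embedding and the vertex set, so that the property passes
  to subfamilies of edges at once.\<close>

definition tight_path_free :: "'a set set \<Rightarrow> bool" where
  "tight_path_free E \<longleftrightarrow>
     (\<forall>a b c d e f. distinct [a, b, c, d, e, f] \<longrightarrow>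
        \<not> ({a, b, c} \<in> E \<and> {b, c, d} \<in> E \<and> {c, d, e} \<in> E \<and> {d, e, f} \<in> E))"

lemma tight_path_freeD:
  assumes "tight_path_free E" "distinct [a, b, c, d, e, f]"
    "{a, b, c} \<in> E" "{b, c, d} \<in> E" "{c, d, e} \<in> E" "{d, e, f} \<in> E"
  shows False
  using assms unfolding tight_path_free_def by blast

lemma tight_path_free_subset:
  assumes "tight_path_free E" "F \<subseteq> E"
  shows "tight_path_free F"
  using assms unfolding tight_path_free_def by blast

lemma finite_shadow:
  assumes "finite E" "\<And>e. e \<in> E \<Longrightarrow> finite e"
  shows "finite (shadow E)"
proof -
  have "shadow E \<subseteq> Pow (\<Union>E)" by (auto simp: shadow_def)
  then show ?thesis using assms by (meson finite_Pow_iff finite_Union finite_subset)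
qed

lemma shadow_mono: "F \<subseteq> E \<Longrightarrow> shadow F \<subseteq> shadow E"
  by (auto simp: shadow_def)

text \<open>Every term counts as 1/2, corrected by 1/2 - 1/3 = 1/6 where the value is 3.\<close>

lemma sum_inverse_two_or_three:
  assumes "finite S" "\<And>z. z \<in> S \<Longrightarrow> f z = 2 \<or> f z = (3::nat)"
  shows "(\<Sum>z\<in>S. 1 / real (f z)) = real (card S) / 2 - real (card {z \<in> S. f z = 3}) / 6"
proof -
  have "(\<Sum>z\<in>S. 1 / real (f z)) = (\<Sum>z\<in>S. 1 / 2 - (if f z = 3 then 1 / 6 else 0))"
    by (rule sum.cong) (use assms(2) in fastforce)+
  also have "\<dots> = real (card S) / 2 - real (card {z \<in> S. f z = 3}) / 6"
    using assms(1) by (simp add: sum_subtractf flip: sum.inter_filter)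
  finally show ?thesis .
qed

section \<open>Critical graphs: links, codegrees and stars\<close>

text \<open>A set \<open>F\<close> violating \<open>critical\<close> destroys at least as many pairs
  as edges, which reduces the inequality to \<open>E - F\<close>; this locale is the case where no
  such reduction exists.\<close>

locale critical_graph =
  fixes E :: "'a set set"
  assumes finite_edges: "finite E"
    and card_edge: "e \<in> E \<Longrightarrow> card e = 3"
    and path_free: "tight_path_free E"
    and critical: "F \<subseteq> E \<Longrightarrow> F \<noteq> {} \<Longrightarrow> card (shadow E - shadow (E - F)) < card F"
begin

abbreviation N :: "'a \<Rightarrow> 'a \<Rightarrow> 'a set" where
  "N \<equiv> link_set E"

definition deg :: "'a set \<Rightarrow> nat" where
  "deg p = card {e \<in> E. p \<subseteq> e}"

text \<open>Filtering \<open>shadow E\<close> by containment, instead of listing the three pairs of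
  \<open>e\<close>, gives a double sum whose order can be swapped directly.\<close>

definition weight :: "'a set \<Rightarrow> real" where
  "weight e = (\<Sum>p\<in>{p \<in> shadow E. p \<subseteq> e}. 1 / real (deg p))"

lemma finite_edge: "e \<in> E \<Longrightarrow> finite e"
  using card_edge card.infinite by fastforce

lemma finite_shadow_E: "finite (shadow E)"
  using finite_shadow finite_edges finite_edge by blast

lemma N_distinct:
  assumes "z \<in> N x y"
  shows "x \<noteq> y" "z \<noteq> x" "z \<noteq> y"
  using card_edge[of "{x, y, z}"] assms
  by (auto simp: link_set_def card_insert_if split: if_splits)

lemma N_commute: "N x y = N y x"
  by (simp add: link_set_def insert_commute)

lemma N_rotate: "z \<in> N x y \<Longrightarrow> y \<in> N x z"
  by (simp add: link_set_def insert_commute)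

lemma N_rotate': "z \<in> N x y \<Longrightarrow> x \<in> N y z"
  by (simp add: link_set_def insert_commute)

lemma finite_N: "finite (N x y)"
proof -
  have "N x y \<subseteq> \<Union>E" by (auto simp: link_set_def)
  then show ?thesis using finite_edges finite_edge by (meson finite_Union finite_subset)
qed

lemma edge_third:
  assumes "e \<in> E" "{x, y} \<subseteq> e" "x \<noteq> y"
  obtains z where "z \<in> N x y" "e = {x, y, z}"
proof -
  have "card (e - {x, y}) = 1"
    using assms card_edge[of e] by (simp add: card_Diff_subset)
  then obtain z where "e - {x, y} = {z}" by (auto simp: card_1_singleton_iff)
  then have "e = {x, y, z}" using assms by blast
  then show ?thesis using that assms by (auto simp: link_set_def)
qed

lemma star_eq:
  assumes "x \<noteq> y"
  shows "{e \<in> E. {x, y} \<subseteq> e} = (\<lambda>z. {x, y, z}) ` N x y"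
proof
  show "{e \<in> E. {x, y} \<subseteq> e} \<subseteq> (\<lambda>z. {x, y, z}) ` N x y"
  proof
    fix e assume "e \<in> {e \<in> E. {x, y} \<subseteq> e}"
    then have "e \<in> E" "{x, y} \<subseteq> e" by simp_all
    then obtain z where "z \<in> N x y" "e = {x, y, z}" using assms by (rule edge_third)
    then show "e \<in> (\<lambda>z. {x, y, z}) ` N x y" by (rule rev_image_eqI)
  qed
qed (auto simp: link_set_def)

lemma inj_star: "inj_on (\<lambda>z. {x, y, z}) (N x y)"
proof (rule inj_onI)
  fix z z' assume "z \<in> N x y" "z' \<in> N x y" "{x, y, z} = {x, y, z'}"
  then show "z = z'" using N_distinct[of z x y] by (metis insert_iff singletonD)
qed

lemma deg_pair: "x \<noteq> y \<Longrightarrow> deg {x, y} = card (N x y)"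
  by (simp add: deg_def star_eq card_image inj_star del: insert_subset)

lemma pair_in_shadow: "z \<in> N x y \<Longrightarrow> {x, y} \<in> shadow E"
  using N_distinct[of z x y] by (auto simp: shadow_def link_set_def intro!: bexI[of _ "{x, y, z}"])

lemma pair_not_in_shadow:
  assumes "x \<noteq> y" "\<And>z. z \<in> N x y \<Longrightarrow> {x, y, z} \<in> F"
  shows "{x, y} \<notin> shadow (E - F)"
proof
  assume "{x, y} \<in> shadow (E - F)"
  then obtain e where e: "e \<in> E" "e \<notin> F" "{x, y} \<subseteq> e" by (auto simp: shadow_def)
  obtain z where "z \<in> N x y" "e = {x, y, z}" using edge_third[OF e(1,3) assms(1)] .
  then show False using assms(2) e(2) by blast
qed

text \<open>A pair lying in a single edge would vanish with that edge, so deleting one edge would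
  destroy at least one pair.\<close>

lemma card_N_ge_2:
  assumes z: "z \<in> N x y"
  shows "card (N x y) \<ge> 2"
proof (rule ccontr)
  assume "\<not> card (N x y) \<ge> 2"
  then have "N x y = {z}"
    using z card_le_Suc0_iff_eq[OF finite_N[of x y]] by fastforce
  then have "{x, y} \<in> shadow E - shadow (E - {{x, y, z}})"
    using pair_in_shadow[OF z] pair_not_in_shadow[of x y] N_distinct[OF z] by auto
  then have "card (shadow E - shadow (E - {{x, y, z}})) > 0"
    using finite_shadow_E by (auto simp: card_gt_0_iff)
  then show False using critical[of "{{x, y, z}}"] z by (simp add: link_set_def)
qed

section \<open>Restrictions on links from the absence of tight paths\<close>

text \<open>Otherwise \<open>a, u, x, y, v, f\<close> is a tight path; \<open>a = f\<close> is the
  only coincidence that the hypotheses leave open.\<close>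

lemma N_ends_equal:
  assumes "u \<in> N x y" "v \<in> N x y" "u \<noteq> v"
    and "a \<in> N x u - {y, v}" "f \<in> N y v - {x, u}"
  shows "a = f"
proof (rule ccontr)
  assume "a \<noteq> f"
  then have "distinct [a, u, x, y, v, f]"
    using assms N_distinct[of u x y] N_distinct[of v x y] N_distinct[of a x u] N_distinct[of f y v]
    by auto
  then show False
    by (rule tight_path_freeD[OF path_free])
      (use assms in \<open>simp_all add: link_set_def insert_commute\<close>)
qed

text \<open>An element of \<open>N y v\<close> outside \<open>{x, u}\<close> would have to equal two
  different vertices of \<open>N x u - {y, v}\<close>. Codegree at least 2 then turns inclusion into
  equality.\<close>

lemma opposite_link:
  assumes "u \<in> N x y" "v \<in> N x y" "u \<noteq> v"
    and "card (N x u - {y, v}) \<ge> 2"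
  shows "N y v = {x, u}"
proof -
  obtain T where "T \<subseteq> N x u - {y, v}" "card T = 2"
    using obtain_subset_with_card_n[OF assms(4)] by blast
  then obtain a b where ab: "a \<in> N x u - {y, v}" "b \<in> N x u - {y, v}" "a \<noteq> b"
    by (auto simp: card_2_iff)
  then have "N y v \<subseteq> {x, u}"
    using N_ends_equal[OF assms(1-3) ab(1)] N_ends_equal[OF assms(1-3) ab(2)] by blast
  moreover have "card (N y v) \<ge> 2"
    using card_N_ge_2[OF N_rotate'[OF assms(2)]] .
  ultimately show ?thesis
    using card_seteq[of "{x, u}" "N y v"] by (simp add: card_insert_if split: if_splits)
qed

lemma opposite_link_heavy:
  assumes "u \<in> N x y" "v \<in> N x y" "u \<noteq> v" "card (N x u) \<ge> 4"
  shows "N y v = {x, u}"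
proof -
  have "card (N x u - {y, v}) \<ge> card (N x u) - card {y, v}"
    by (simp add: diff_card_le_card_Diff)
  moreover have "card {y, v} \<le> 2" by (simp add: card_insert_if)
  ultimately show ?thesis using assms(4) by (intro opposite_link[OF assms(1-3)]) linarith
qed

lemma heavy_pair_unique:
  assumes z: "z \<in> N x y" and xy: "card (N x y) \<ge> 4"
  shows "card (N x z) \<le> 3"
proof (rule ccontr)
  assume "\<not> card (N x z) \<le> 3"
  then have xz: "card (N x z) \<ge> 4" by simp
  \<comment> \<open>The heavy pair \<open>xz\<close> forces all these links; the resulting edges
    \<open>yzv\<close> make the third pair \<open>yz\<close> heavy as well.\<close>
  have yv: "N y v = {x, z}" if "v \<in> N x y - {z}" for v
    using opposite_link_heavy[of z x y v] z that xz by auto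
  have "N x y - {z} \<subseteq> N y z - {x}"
  proof
    fix v assume v: "v \<in> N x y - {z}"
    then have "z \<in> N y v" using yv by simp
    then show "v \<in> N y z - {x}" using v N_rotate N_distinct(2)[of v x y] by simp
  qed
  then have "card (N x y - {z}) \<le> card (N y z - {x})"
    by (intro card_mono) (simp_all add: finite_N)
  moreover have "x \<in> N y z" using z by (rule N_rotate')
  ultimately have yz: "card (N y z) \<ge> 4"
    using xy z finite_N[of y z] by (simp add: finite_N card_gt_0_iff)
  have "N x y \<noteq> {z}" using xy by auto
  then obtain v where v: "v \<in> N x y" "v \<noteq> z" using z by blast
  have Nyv: "N y v = {x, z}" using yv v by simp
  have Nxv: "N x v = {y, z}"
    using opposite_link_heavy[of z y x v] z v yz by (simp add: N_commute)
  have "v \<in> N y z" using Nyv N_rotate by blast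
  have "v \<in> N x z" using Nxv N_rotate by blast
  moreover have "y \<in> N x z" using z N_rotate by blast
  ultimately have Nzv: "N z v = {x, y}"
    using opposite_link_heavy[of y x z v] N_distinct[OF v(1)] xy by simp
  let ?F = "{{x, y, v}, {x, z, v}, {y, z, v}}"
  let ?L = "{{x, v}, {y, v}, {z, v}}"
  note dist = N_distinct[OF z] N_distinct[OF v(1)] v(2)
  have "?F \<subseteq> E"
    using v(1) \<open>v \<in> N x z\<close> \<open>v \<in> N y z\<close> by (simp add: link_set_def)
  have "?L \<subseteq> shadow E"
    using Nxv Nyv Nzv pair_in_shadow by blast
  moreover have "{x, v} \<notin> shadow (E - ?F)" "{y, v} \<notin> shadow (E - ?F)" "{z, v} \<notin> shadow (E - ?F)"
    by (rule pair_not_in_shadow; use dist Nxv Nyv Nzv in \<open>auto simp: insert_commute\<close>)+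
  ultimately have "?L \<subseteq> shadow E - shadow (E - ?F)" by blast
  then have "card ?L \<le> card (shadow E - shadow (E - ?F))"
    by (intro card_mono) (simp_all add: finite_shadow_E)
  moreover have "card ?L = 3" using dist by (auto simp: card_insert_if doubleton_eq_iff)
  moreover have "card ?F \<le> 3" by (simp add: card_insert_if)
  ultimately show False using critical[OF \<open>?F \<subseteq> E\<close>] by simp
qed

lemma card_N_cases:
  assumes "z \<in> N x y" "card (N x y) \<ge> 4"
  shows "card (N x z) = 2 \<or> card (N x z) = 3"
proof -
  have "card (N x z) \<ge> 2" using card_N_ge_2[OF N_rotate[OF assms(1)]] .
  then show ?thesis using heavy_pair_unique[OF assms] by auto
qed

section \<open>Weights and double counting\<close>

lemma weight_edge:
  assumes z: "z \<in> N x y"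
  shows "weight {x, y, z} =
    1 / real (card (N x y)) + 1 / real (card (N x z)) + 1 / real (card (N y z))"
proof -
  note dist = N_distinct[OF z]
  have "{p \<in> shadow E. p \<subseteq> {x, y, z}} = {{x, y}, {x, z}, {y, z}}" (is "?A = ?B")
  proof
    show "?A \<subseteq> ?B"
      by (auto simp: shadow_def card_2_iff)
    show "?B \<subseteq> ?A"
      using pair_in_shadow[OF z] pair_in_shadow[OF N_rotate[OF z]] pair_in_shadow[OF N_rotate'[OF z]]
      by simp
  qed
  then show ?thesis
    using dist by (auto simp: weight_def doubleton_eq_iff deg_pair)
qed

text \<open>After exchanging the sums, each pair \<open>p\<close> collects \<open>1 / deg p\<close>
  from exactly \<open>deg p\<close> edges.\<close>

lemma card_shadow: "real (card (shadow E)) = (\<Sum>e\<in>E. weight e)"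
proof -
  have "(\<Sum>e\<in>E. weight e) = (\<Sum>p\<in>shadow E. \<Sum>e\<in>{e \<in> E. p \<subseteq> e}. 1 / real (deg p))"
    unfolding weight_def by (rule sum.swap_restrict) (simp_all add: finite_edges finite_shadow_E)
  also have "\<dots> = (\<Sum>p\<in>shadow E. 1)"
  proof (rule sum.cong)
    fix p assume "p \<in> shadow E"
    then have "deg p > 0"
      using finite_edges by (auto simp: deg_def shadow_def card_gt_0_iff)
    then show "(\<Sum>e\<in>{e \<in> E. p \<subseteq> e}. 1 / real (deg p)) = 1"
      by (simp add: deg_def)
  qed simp
  finally show ?thesis by simp
qed

section \<open>Codegree-3 pairs around a heavy pair\<close>

text \<open>Since \<open>v\<close> is not in \<open>N x u\<close>, removing \<open>y\<close> and
  \<open>v\<close> costs only \<open>y\<close>, which leaves the two elements that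
  \<open>opposite_link\<close> requires.\<close>

lemma degree_three_link:
  assumes "u \<in> N x y" "card (N x u) = 3" "v \<in> N x y" "v \<noteq> u" "v \<notin> N x u"
  shows "N y v = {x, u}"
proof (rule opposite_link)
  have "y \<in> N x u" using assms(1) N_rotate by blast
  moreover have "N x u - {y, v} = N x u - {y}" using assms(5) by blast
  ultimately show "2 \<le> card (N x u - {y, v})" using assms(2) by (simp add: finite_N)
qed (use assms(1,3,4) in simp_all)

text \<open>Write \<open>N x u = {y, a, b}\<close>. Any \<open>v\<close> in \<open>N x y\<close>
  other than \<open>u, a, b\<close> has \<open>N y v = {x, u}\<close>, of size 2, so codegree 3 at
  \<open>y\<close> occurs only for \<open>u, a, b\<close>.\<close>

lemma degree_three_bounds:
  assumes u: "u \<in> N x y" and xu: "card (N x u) = 3" and xy: "card (N x y) \<ge> 4"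
  shows "card {v \<in> N x y. card (N y v) = 3} \<le> 3" "card (N x y) \<le> 5"
proof -
  note link = degree_three_link[OF u xu]
  have y: "y \<in> N x u" and x: "x \<in> N y u" using u by (fact N_rotate, fact N_rotate')
  have "card (N y u) \<le> 3"
    using heavy_pair_unique[of u y x] u xy by (simp add: N_commute)
  then have yu: "card (N y u - {x}) \<le> 2" using x by (simp add: finite_N)
  have xu': "card (N x u - {y}) = 2" using y xu by (simp add: finite_N)
  have sub1: "{v \<in> N x y. card (N y v) = 3} \<subseteq> insert u (N x u - {y})"
  proof
    fix v assume v: "v \<in> {v \<in> N x y. card (N y v) = 3}"
    then have "N y v \<noteq> {x, u}" by (auto simp: card_insert_if split: if_splits)
    then show "v \<in> insert u (N x u - {y})" using v link N_distinct by blast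
  qed
  then have "card {v \<in> N x y. card (N y v) = 3} \<le> card (insert u (N x u - {y}))"
    by (intro card_mono) (simp_all add: finite_N)
  also have "\<dots> \<le> 3" using xu' by (simp add: card_insert_if finite_N)
  finally show "card {v \<in> N x y. card (N y v) = 3} \<le> 3" .
  \<comment> \<open>A \<open>v\<close> outside \<open>{u, a, b}\<close> has \<open>u\<close> in
    \<open>N y v\<close>, hence lies in \<open>N y u - {x}\<close>, which has at most 2 elements: 1
    + 2 + 2 = 5.\<close>
  have "N x y \<subseteq> insert u ((N x u - {y}) \<union> (N y u - {x}))"
  proof
    fix v assume v: "v \<in> N x y"
    show "v \<in> insert u ((N x u - {y}) \<union> (N y u - {x}))"
    proof (cases "v = u \<or> v \<in> N x u")
      case True
      then show ?thesis using N_distinct[OF v] by blast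
    next
      case False
      then have "u \<in> N y v" using link v by blast
      then show ?thesis using N_rotate N_distinct[OF v] by blast
    qed
  qed
  then have "card (N x y) \<le> card (insert u ((N x u - {y}) \<union> (N y u - {x})))"
    by (intro card_mono) (simp_all add: finite_N)
  also have "\<dots> \<le> Suc (card ((N x u - {y}) \<union> (N y u - {x})))"
    by (simp add: card_insert_if finite_N)
  also have "\<dots> \<le> 5"
    using card_Un_le[of "N x u - {y}" "N y u - {x}"] xu' yu by simp
  finally show "card (N x y) \<le> 5" .
qed

text \<open>A codegree-3 pair at one end bounds the count at the other end by 3. If both counts are
  nonzero this gives 3 + 3; if only one is, it is at most \<open>card (N x y)\<close>, hence at most
  5.\<close>

lemma card_degree_three:
  assumes xy: "card (N x y) \<ge> 4"
  shows "card {z \<in> N x y. card (N x z) = 3} + card {z \<in> N x y. card (N y z) = 3} \<le> 6"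
    (is "card ?A + card ?B \<le> 6")
proof -
  have A: "card ?B \<le> 3" "card (N x y) \<le> 5" if "?A \<noteq> {}"
    using that degree_three_bounds[of _ x y] xy by blast+
  have B: "card ?A \<le> 3" "card (N x y) \<le> 5" if "?B \<noteq> {}"
    using that degree_three_bounds[of _ y x] xy N_commute[of y x] by auto
  have "card ?A \<le> card (N x y)" "card ?B \<le> card (N x y)"
    by (auto intro!: card_mono finite_N)
  moreover have "card ?A = 0" if "?A = {}" using that by (simp only: card.empty)
  moreover have "card ?B = 0" if "?B = {}" using that by (simp only: card.empty)
  ultimately show ?thesis using A B by linarith
qed

lemma weight_star:
  assumes xy: "card (N x y) \<ge> 4"
  shows "(\<Sum>e\<in>{e \<in> E. {x, y} \<subseteq> e}. weight e) \<ge> real (card (N x y))"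
proof -
  have "N x y \<noteq> {}" using xy by auto
  then have "x \<noteq> y" using N_distinct by blast
  then have "(\<Sum>e\<in>{e \<in> E. {x, y} \<subseteq> e}. weight e) = (\<Sum>z\<in>N x y. weight {x, y, z})"
    by (simp add: star_eq sum.reindex[OF inj_star] del: insert_subset)
  also have "\<dots> = (\<Sum>z\<in>N x y. 1 / real (card (N x y))) + (\<Sum>z\<in>N x y. 1 / real (card (N x z)))
      + (\<Sum>z\<in>N x y. 1 / real (card (N y z)))"
    by (simp add: weight_edge sum.distrib)
  also have "(\<Sum>z\<in>N x y. 1 / real (card (N x y))) = 1"
    using xy by auto
  also have "(\<Sum>z\<in>N x y. 1 / real (card (N x z))) =
      real (card (N x y)) / 2 - real (card {z \<in> N x y. card (N x z) = 3}) / 6"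
    by (rule sum_inverse_two_or_three) (use card_N_cases[of _ x y] xy finite_N in auto)
  also have "(\<Sum>z\<in>N x y. 1 / real (card (N y z))) =
      real (card (N x y)) / 2 - real (card {z \<in> N x y. card (N y z) = 3}) / 6"
    by (rule sum_inverse_two_or_three)
      (use card_N_cases[of _ y x] xy finite_N N_commute[of x y] in auto)
  finally show ?thesis
    using card_degree_three[OF xy] by linarith
qed

section \<open>Summing over heavy stars and light edges\<close>

text \<open>Two distinct pairs inside a 3-set share a vertex, so \<open>heavy_pair_unique\<close>
  applies. Hence stars of heavy pairs are disjoint and their weights can be added.\<close>

lemma heavy_pairs_disjoint:
  assumes "e \<in> E" "p \<in> shadow E" "q \<in> shadow E" "p \<subseteq> e" "q \<subseteq> e" "deg p \<ge> 4" "deg q \<ge> 4"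
  shows "p = q"
proof (rule ccontr)
  assume "p \<noteq> q"
  have cp: "card p = 2" and cq: "card q = 2" using assms by (auto simp: shadow_def)
  then have fin: "finite p" "finite q" by (auto intro: card_ge_0_finite)
  have "card (p \<union> q) \<le> 3"
    using card_mono[of e "p \<union> q"] card_edge[OF assms(1)] finite_edge assms by auto
  then have "p \<inter> q \<noteq> {}"
    using card_Un_disjoint[OF fin] cp cq by auto
  then obtain x where x: "x \<in> p" "x \<in> q" by blast
  then obtain y z where "p = {x, y}" "q = {x, z}" "x \<noteq> y" "x \<noteq> z"
    using cp cq by (auto simp: card_2_iff)
  moreover have "z \<in> N x y"
  proof -
    have "{x, y} \<subseteq> e" "z \<in> e" "z \<noteq> y" using calculation assms \<open>p \<noteq> q\<close> by auto
    moreover obtain w where "w \<in> N x y" "e = {x, y, w}"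
      using edge_third[OF assms(1) \<open>{x, y} \<subseteq> e\<close> \<open>x \<noteq> y\<close>] .
    ultimately show ?thesis using \<open>x \<noteq> z\<close> by auto
  qed
  ultimately show False
    using heavy_pair_unique[of z x y] assms by (simp add: deg_pair)
qed

lemma weight_light:
  assumes e: "e \<in> E" and light: "\<And>p. p \<in> shadow E \<Longrightarrow> p \<subseteq> e \<Longrightarrow> deg p < 4"
  shows "weight e \<ge> 1"
proof -
  obtain x y z where xyz: "e = {x, y, z}" "x \<noteq> y" "y \<noteq> z" "x \<noteq> z"
    using card_edge[OF e] by (auto simp: card_3_iff)
  then have N: "z \<in> N x y" "y \<in> N x z" "x \<in> N y z"
    using e by (simp_all add: link_set_def insert_commute)
  have inv: "1 / real (card (N a b)) \<ge> 1 / 3" if "c \<in> N a b" "{a, b} \<subseteq> e" for a b c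
  proof -
    have "card (N a b) < 4"
      using light[of "{a, b}"] pair_in_shadow that N_distinct[OF that(1)] by (simp add: deg_pair)
    then show ?thesis using card_N_ge_2[OF that(1)] by (intro divide_left_mono) auto
  qed
  show ?thesis
    using inv[OF N(1)] inv[OF N(2)] inv[OF N(3)] weight_edge[OF N(1)] xyz(1) by simp
qed

lemma card_edges_le_card_shadow: "card E \<le> card (shadow E)"
proof -
  define H where "H = {p \<in> shadow E. deg p \<ge> 4}"
  define star where "star p = {e \<in> E. p \<subseteq> e}" for p
  \<comment> \<open>The edges split into the disjoint heavy stars, forming \<open>U\<close>, and the
    edges without a heavy pair; on both parts the average weight is at least 1.\<close>
  define U where "U = (\<Union>p\<in>H. star p)"
  have finH: "finite H" using finite_shadow_E by (simp add: H_def)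
  have fin_star: "finite (star p)" for p using finite_edges by (simp add: star_def)
  have disj: "\<forall>p\<in>H. \<forall>q\<in>H. p \<noteq> q \<longrightarrow> star p \<inter> star q = {}"
    using heavy_pairs_disjoint by (auto simp: H_def star_def)
  have "U \<subseteq> E" by (auto simp: U_def star_def)
  have "real (card U) = (\<Sum>p\<in>H. real (card (star p)))"
    unfolding U_def using card_UN_disjoint[OF finH _ disj] fin_star by simp
  also have "\<dots> \<le> (\<Sum>p\<in>H. \<Sum>e\<in>star p. weight e)"
  proof (rule sum_mono)
    fix p assume p: "p \<in> H"
    then obtain x y where "p = {x, y}" "x \<noteq> y" by (auto simp: H_def shadow_def card_2_iff)
    then show "real (card (star p)) \<le> (\<Sum>e\<in>star p. weight e)"
      using p weight_star[of x y] deg_pair[of x y] unfolding H_def star_def deg_def by simp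
  qed
  also have "\<dots> = (\<Sum>e\<in>U. weight e)"
    unfolding U_def by (rule sum.UNION_disjoint[OF finH _ disj, symmetric]) (simp add: fin_star)
  finally have heavy: "real (card U) \<le> (\<Sum>e\<in>U. weight e)" .
  have "real (card (E - U)) = (\<Sum>e\<in>E - U. 1)" by simp
  also have "\<dots> \<le> (\<Sum>e\<in>E - U. weight e)"
    by (intro sum_mono weight_light) (auto simp: U_def H_def star_def not_le[symmetric])
  finally have "real (card (E - U)) \<le> (\<Sum>e\<in>E - U. weight e)" .
  moreover have "(\<Sum>e\<in>E. weight e) = (\<Sum>e\<in>E - U. weight e) + (\<Sum>e\<in>U. weight e)"
    using sum.subset_diff[OF \<open>U \<subseteq> E\<close> finite_edges] .
  moreover have "card E = card (E - U) + card U"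
    using \<open>U \<subseteq> E\<close> finite_edges by (metis add.commute card_Diff_subset card_mono finite_subset
        le_add_diff_inverse)
  ultimately have "real (card E) \<le> real (card (shadow E))"
    using heavy card_shadow by simp
  then show ?thesis by simp
qed

end

section \<open>Reduction to critical graphs\<close>

text \<open>Induction over proper subsets: either \<open>E\<close> is critical, or some nonempty
  \<open>F\<close> can be deleted and the inequality for \<open>E - F\<close> is added to the one
  for \<open>F\<close>.\<close>

lemma tight_path_free_card_le:
  fixes E :: "'a set set"
  assumes "finite E" "\<And>e. e \<in> E \<Longrightarrow> card e = 3" "tight_path_free E"
  shows "card E \<le> card (shadow E)"
  using assms
proof (induction E rule: finite_psubset_induct)
  case (psubset E)
  show ?case
  proof (cases "\<forall>F \<subseteq> E. F \<noteq> {} \<longrightarrow> card (shadow E - shadow (E - F)) < card F")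
    case True
    then interpret critical_graph E
      using psubset by unfold_locales auto
    show ?thesis by (rule card_edges_le_card_shadow)
  next
    case False
    then obtain F where F: "F \<subseteq> E" "F \<noteq> {}" "card F \<le> card (shadow E - shadow (E - F))"
      by (auto simp: not_less)
    have "finite (shadow E)"
      using finite_shadow psubset by (metis card.infinite zero_neq_numeral)
    then have "card (shadow E) = card (shadow E - shadow (E - F)) + card (shadow (E - F))"
      using shadow_mono[of "E - F" E]
      by (metis Diff_subset add.commute card_Diff_subset card_mono finite_subset
          le_add_diff_inverse)
    moreover have "card E = card F + card (E - F)"
      using F(1) psubset.hyps by (metis card_Diff_subset card_mono finite_subset
          le_add_diff_inverse)
    moreover have "card (E - F) \<le> card (shadow (E - F))"
      using F psubset tight_path_free_subset[of E "E - F"] by (intro psubset.IH) auto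
    ultimately show ?thesis using F(3) by linarith
  qed
qed

section \<open>From embeddings to named vertices\<close>

lemma tight_path_free_if_no_copy:
  assumes "\<And>e. e \<in> E \<Longrightarrow> e \<subseteq> V"
    and "\<not> contains_copy V E tight_path4_verts tight_path4_edges"
  shows "tight_path_free E"
  unfolding tight_path_free_def
proof (intro allI impI notI, elim conjE)
  fix a b c d e f
  assume dist: "distinct [a, b, c, d, e, f]"
    and edges: "{a, b, c} \<in> E" "{b, c, d} \<in> E" "{c, d, e} \<in> E" "{d, e, f} \<in> E"
  \<comment> \<open>The path vertices are numbered from 1 and list positions from 0, hence the
    shift.\<close>
  define g where "g i = [a, b, c, d, e, f] ! (i - 1)" for i :: nat
  have g: "g 1 = a" "g (Suc 0) = a" "g 2 = b" "g 3 = c" "g 4 = d" "g 5 = e" "g 6 = f"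
    by (simp_all add: g_def)
  have verts: "tight_path4_verts = {1, 2, 3, 4, 5, 6}"
    by (auto simp: tight_path4_verts_def)
  have "inj_on g tight_path4_verts"
    unfolding verts using dist by (auto simp: g)
  moreover have "g ` tight_path4_verts \<subseteq> V"
    unfolding verts using assms(1)[OF edges(1)] assms(1)[OF edges(4)] by (simp add: g)
  moreover have "\<forall>s\<in>tight_path4_edges. g ` s \<in> E"
    using edges by (simp add: tight_path4_edges_def g)
  ultimately show False
    using assms(2) unfolding contains_copy_def by blast
qed

theorem lemma5p1:
  fixes V :: "'a set" and E :: "'a set set" and n :: nat
  assumes "n \<ge> 5"
    and "three_graph V E"
    and "card V = n"
    and "\<not> contains_copy V E tight_path4_verts tight_path4_edges"
  shows "card E \<le> card (shadow E)"
proof (rule tight_path_free_card_le)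
  have "E \<subseteq> Pow V" "finite V" using assms(2) by (auto simp: three_graph_def)
  then show "finite E" by (meson finite_Pow_iff finite_subset)
  show "tight_path_free E"
    using tight_path_free_if_no_copy assms(2,4) unfolding three_graph_def by blast
qed (use assms(2) in \<open>simp add: three_graph_def\<close>)

end
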